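(* Let $F(x,y)$ be a harmonic function and let $\tilde F(x,y)$ be its harmonic conjugate, in the sense that $F+i\tilde F$ is a holomorphic function of $\zeta=y+ix$. Consider the shock pp-waves $$ds^2=-dt^2+dx^2+dy^2+dz^2+F(x,y)\,\delta(t-z)\,(dt-dz)^2$$ and $$d\tilde s^2=-dt^2+dx^2+dy^2+dz^2+\tilde F(x,y)\,\delta(t-z)\,(dt-dz)^2 .$$ Then the second is the gravitational dual of the first: their linearized Riemann tensors $R$ and $\tilde R$ satisfy $$\tilde R_{\alpha\beta\lambda\mu}=\tfrac12\,\epsilon_{\alpha\beta\gamma\delta}\,R^{\gamma\delta}{}_{\lambda\mu}.$$
   Context: Coordinates are ordered $(t,x,y,z)=(x^0,x^1,x^2,x^3)$; the background is $\eta_{\mu\nu}=\mathrm{diag}(-1,1,1,1)$, used to move indices, and $\epsilon_{0123}=+1$. For a metric $\eta_{\mu\nu}+h_{\mu\nu}$, the linearized Riemann tensor is $R_{\alpha\beta\gamma\delta}=2\,\partial_{[\alpha}h_{\beta][\gamma,\delta]}=\frac12\left(\partial_\alpha\partial_\delta h_{\beta\gamma}-\partial_\alpha\partial_\gamma h_{\beta\delta}-\partial_\beta\partial_\delta h_{\alpha\gamma}+\partial_\beta\partial_\gamma h_{\alpha\delta}\right)$. Here $h_{\mu\nu}dx^\mu dx^\nu=F\,\delta(t-z)(dt-dz)^2$ (resp. with $\tilde F$), $\delta$ being the Dirac distribution, and identities are understood in the sense of distributions on the domain of the $(x,y)$-plane where $F$ and $\tilde F$ are defined. *)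

theory Defs
  imports "HOL-Analysis.Analysis"
begin

text \<open>
  Space-time is \<^typ>\<open>real^4\<close>; the elements of the index type \<^typ>\<open>4\<close> are \<open>0, 1, 2, 3\<close>
  (with \<open>4 = 0\<close>), so that \<open>p $ 0, p $ 1, p $ 2, p $ 3\<close> are the coordinates \<open>t, x, y, z\<close> of \<open>p\<close>.
\<close>

definition event :: "real \<Rightarrow> real \<Rightarrow> real \<Rightarrow> real \<Rightarrow> real^4" where
  "event t x y z = (\<chi> i. if i = 0 then t else if i = 1 then x else if i = 2 then y else z)"

section \<open>Partial derivatives, harmonic functions and test functions\<close>

definition partial :: "'a::euclidean_space \<Rightarrow> ('a \<Rightarrow> real) \<Rightarrow> 'a \<Rightarrow> real" where
  "partial b f x = frechet_derivative f (at x) b"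

definition harmonic_on :: "'a::euclidean_space set \<Rightarrow> ('a \<Rightarrow> real) \<Rightarrow> bool" where
  "harmonic_on D f \<longleftrightarrow>
     (\<forall>x\<in>D. f differentiable (at x)) \<and>
     (\<forall>b\<in>Basis. \<forall>x\<in>D. partial b f differentiable (at x)) \<and>
     (\<forall>b\<in>Basis. \<forall>c\<in>Basis. continuous_on D (partial c (partial b f))) \<and>
     (\<forall>x\<in>D. (\<Sum>b\<in>Basis. partial b (partial b f) x) = 0)"

text \<open>All iterated partial derivatives being differentiable everywhere amounts to \<open>C\<^sup>\<infinity>\<close>.\<close>

definition smooth :: "('a::euclidean_space \<Rightarrow> real) \<Rightarrow> bool" where
  "smooth \<phi> \<longleftrightarrow>
     (\<forall>bs. set bs \<subseteq> Basis \<longrightarrow> (\<forall>x. foldr partial bs \<phi> differentiable (at x)))"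

definition test_functions :: "'a::euclidean_space set \<Rightarrow> ('a \<Rightarrow> real) set" where
  "test_functions \<Omega> =
     {\<phi>. smooth \<phi> \<and> compact (closure {x. \<phi> x \<noteq> 0}) \<and> closure {x. \<phi> x \<noteq> 0} \<subseteq> \<Omega>}"

section \<open>Distributions on space-time\<close>

text \<open>
  Distributions are represented by their action on test functions; an identity of distributions
  on an open set \<open>\<Omega>\<close> is equality of the values on every element of \<open>test_functions \<Omega>\<close>.
\<close>

type_synonym distr = "(real^4 \<Rightarrow> real) \<Rightarrow> real"

definition distr_deriv :: "4 \<Rightarrow> distr \<Rightarrow> distr" where
  "distr_deriv i T = (\<lambda>\<phi>. - T (partial (axis i 1) \<phi>))"

definition distr_mult :: "(real^4 \<Rightarrow> real) \<Rightarrow> distr \<Rightarrow> distr" where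
  "distr_mult f T = (\<lambda>\<phi>. T (\<lambda>p. f p * \<phi> p))"

definition dirac :: "(real \<Rightarrow> real) \<Rightarrow> real" where
  "dirac \<psi> = \<psi> 0"

text \<open>
  \<open>\<delta>(t - z)\<close>, the Dirac distribution composed with \<open>t - z\<close>: the formal integral of
  \<open>\<delta>(t - z) \<phi>(t,x,y,z)\<close>, with \<open>t = s + z\<close> substituted (unit Jacobian).
\<close>

definition dirac_t_minus_z :: distr where
  "dirac_t_minus_z =
     (\<lambda>\<phi>. dirac (\<lambda>s. integral\<^sup>L lborel (\<lambda>(x, y, z). \<phi> (event (s + z) x y z))))"

section \<open>Linearized gravity on the Minkowski background\<close>

definition eta :: "real^4^4" where
  "eta = (\<chi> \<mu> \<nu>. if \<mu> = \<nu> then (if \<mu> = 0 then -1 else 1) else 0)"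

definition levi_civita :: "4 \<Rightarrow> 4 \<Rightarrow> 4 \<Rightarrow> 4 \<Rightarrow> real" where
  "levi_civita \<alpha> \<beta> \<gamma> \<delta> =
     (let p = (\<lambda>i::4. if i = 0 then \<alpha> else if i = 1 then \<beta> else if i = 2 then \<gamma> else \<delta>)
      in if bij p then of_int (sign p) else 0)"

definition lin_riemann ::
    "(4 \<Rightarrow> 4 \<Rightarrow> distr) \<Rightarrow> 4 \<Rightarrow> 4 \<Rightarrow> 4 \<Rightarrow> 4 \<Rightarrow> distr" where
  "lin_riemann h \<alpha> \<beta> \<gamma> \<delta> = (\<lambda>\<phi>. 1/2 *
     (distr_deriv \<alpha> (distr_deriv \<delta> (h \<beta> \<gamma>)) \<phi>
    - distr_deriv \<alpha> (distr_deriv \<gamma> (h \<beta> \<delta>)) \<phi>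
    - distr_deriv \<beta> (distr_deriv \<delta> (h \<alpha> \<gamma>)) \<phi>
    + distr_deriv \<beta> (distr_deriv \<gamma> (h \<alpha> \<delta>)) \<phi>))"

text \<open>\<open>T\<^bsub>\<gamma>\<delta>\<kappa>\<mu>\<^esub>\<close> with its first two indices raised.\<close>

definition raise_first_two ::
    "(4 \<Rightarrow> 4 \<Rightarrow> 4 \<Rightarrow> 4 \<Rightarrow> distr) \<Rightarrow> 4 \<Rightarrow> 4 \<Rightarrow> 4 \<Rightarrow> 4 \<Rightarrow> distr" where
  "raise_first_two T \<gamma> \<delta> \<kappa> \<mu> = (\<lambda>\<phi>.
     \<Sum>\<rho>\<in>UNIV. \<Sum>\<sigma>\<in>UNIV. matrix_inv eta $ \<gamma> $ \<rho> * matrix_inv eta $ \<delta> $ \<sigma> * T \<rho> \<sigma> \<kappa> \<mu> \<phi>)"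

text \<open>
  \<open>F(x,y) \<delta>(t - z) (dt - dz)\<^sup>2\<close>, where \<open>k\<close> holds the components of the covector \<open>dt - dz\<close>.
\<close>

definition shock_wave :: "(real \<times> real \<Rightarrow> real) \<Rightarrow> 4 \<Rightarrow> 4 \<Rightarrow> distr" where
  "shock_wave F \<mu> \<nu> =
     (let k = (\<lambda>i::4. if i = 0 then 1 else if i = 3 then -1 else 0)
      in (\<lambda>\<phi>. k \<mu> * k \<nu> * distr_mult (\<lambda>p. F (p $ 1, p $ 2)) dirac_t_minus_z \<phi>))"

end

theory Submission
  imports Defs
begin

text \<open>
  Paired with a test function, \<open>F \<delta>(t - z)\<close> integrates \<open>F\<close> against its restriction to the null
  hyperplane \<open>t = z\<close>. Integrating by parts in \<open>z\<close> gives \<open>(\<partial>\<^sub>t + \<partial>\<^sub>z)(F \<delta>) = 0\<close>, and integrating by parts in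
  \<open>x\<close> and \<open>y\<close> turns the Cauchy-Riemann equations of \<open>F + i F'\<close> in \<open>y + i x\<close> into
  \<open>\<partial>\<^sub>x (F' \<delta>) = \<partial>\<^sub>y (F \<delta>)\<close> and \<open>\<partial>\<^sub>y (F' \<delta>) = - \<partial>\<^sub>x (F \<delta>)\<close>. With \<open>k = dt - dz\<close>, the Hodge star sends \<open>k \<and> dx\<close> to
  \<open>- k \<and> dy\<close> and \<open>k \<and> dy\<close> to \<open>k \<and> dx\<close>, and the curvature is linear in these bivectors with coefficients
  the second derivatives of \<open>F \<delta>\<close>.
\<close>

section \<open>Integrals of directional derivatives\<close>

lemma has_real_derivative_along_line:
  fixes g :: "'a::real_normed_vector \<Rightarrow> real"
  assumes "(g has_derivative g') (at (x + t *\<^sub>R v))"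
  shows "((\<lambda>t. g (x + t *\<^sub>R v)) has_real_derivative g' v) (at t)"
proof -
  have "((\<lambda>t. x + t *\<^sub>R v) has_derivative (\<lambda>s. s *\<^sub>R v)) (at t)"
    by (auto intro!: derivative_eq_intros)
  from has_derivative_compose[OF this assms]
  have "((\<lambda>t. g (x + t *\<^sub>R v)) has_derivative (\<lambda>s. g' (s *\<^sub>R v))) (at t)" .
  moreover have "g' (s *\<^sub>R v) = s * g' v" for s
    using linear_scale[OF has_derivative_linear[OF assms]] by simp
  ultimately show ?thesis
    by (simp add: has_field_derivative_def mult_commute_abs)
qed

lemma integral_lborel_translate:
  fixes g :: "'a::euclidean_space \<Rightarrow> real"
  assumes "g \<in> borel_measurable borel"
  shows "(\<integral>x. g (x + c) \<partial>lborel) = (\<integral>x. g x \<partial>lborel)"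
proof -
  have "(\<integral>x. g x \<partial>distr lborel borel ((+) c)) = (\<integral>x. g (c + x) \<partial>lborel)"
    using assms by (intro integral_distr) auto
  then show ?thesis
    by (simp add: lborel_distr_plus add.commute)
qed

lemma integrable_lborel_compact_support:
  fixes g :: "'a::euclidean_space \<Rightarrow> real"
  assumes "continuous_on UNIV g" "compact K" "\<And>x. x \<notin> K \<Longrightarrow> g x = 0"
  shows "integrable lborel g"
proof -
  have "integrable lborel (\<lambda>x. indicator K x *\<^sub>R g x)"
    using assms by (intro borel_integrable_compact) (auto intro: continuous_on_subset)
  also have "(\<lambda>x. indicator K x *\<^sub>R g x) = g"
    using assms(3) by (auto simp: indicator_def fun_eq_iff)
  finally show ?thesis .
qed

text \<open>
  By translation invariance the difference quotients of \<open>g\<close> have integral \<open>0\<close>; dominated convergence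
  passes to the limit.
\<close>

lemma integral_directional_derivative_eq_0:
  fixes g :: "'a::euclidean_space \<Rightarrow> real"
  assumes der: "\<And>x. (g has_derivative g' x) (at x)"
    and cont: "continuous_on UNIV (\<lambda>x. g' x v)"
    and "compact K" and zero: "\<And>x. x \<notin> K \<Longrightarrow> g x = 0"
  shows "(\<integral>x. g' x v \<partial>lborel) = 0"
proof -
  obtain r where r: "\<And>x. x \<in> K \<Longrightarrow> norm x \<le> r"
    using compact_imp_bounded[OF \<open>compact K\<close>] by (auto simp: bounded_iff)
  \<comment> \<open>The quotients below use steps of length at most \<open>norm v\<close>, so they
    vanish outside the ball of radius \<open>r + norm v\<close>; mean value points for
    \<open>x\<close> in that ball lie within another \<open>norm v\<close>. Hence the radius
    \<open>r + 2 * norm v\<close> for the derivative bound \<open>M\<close>.\<close>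
  have "compact ((\<lambda>x. g' x v) ` cball 0 (r + 2 * norm v))"
    by (intro compact_continuous_image continuous_on_subset[OF cont]) auto
  then obtain M where M: "\<And>x. norm x \<le> r + 2 * norm v \<Longrightarrow> \<bar>g' x v\<bar> \<le> M"
    using compact_imp_bounded by (fastforce simp: bounded_iff)
  have gcont: "continuous_on UNIV g"
    using der by (meson continuous_at_imp_continuous_on has_derivative_continuous)
  have gmeas: "g \<in> borel_measurable borel"
    using gcont by (rule borel_measurable_continuous_onI)
  have gint: "integrable lborel g"
    using gcont \<open>compact K\<close> zero by (rule integrable_lborel_compact_support)
  define s where "s n = inverse (real (Suc n))" for n
  have s: "0 < s n" "s n \<le> 1" for n
    by (auto simp: s_def field_simps)
  have s0: "s \<longlonglongrightarrow> 0"
    unfolding s_def by (rule LIMSEQ_inverse_real_of_nat)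
  define q where "q n x = (g (x + s n *\<^sub>R v) - g x) / s n" for n x
  \<comment> \<open>The dominating function: inside the ball the mean value theorem bounds a
    quotient by \<open>M\<close>, and outside it both \<open>x\<close> and
    \<open>x + s n *\<^sub>R v\<close> miss \<open>K\<close>.\<close>
  define w where "w = (\<lambda>x::'a. indicator (cball 0 (r + norm v)) x *\<^sub>R M)"
  have shift: "integrable lborel (\<lambda>x. g (x + c))" for c
  proof (rule integrable_lborel_compact_support)
    show "continuous_on UNIV (\<lambda>x. g (x + c))"
      by (intro continuous_on_compose2[OF gcont] continuous_intros) auto
    show "compact ((\<lambda>x. x - c) ` K)"
      using \<open>compact K\<close> by (intro compact_continuous_image continuous_intros)
    show "g (x + c) = 0" if "x \<notin> (\<lambda>x. x - c) ` K" for x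
      using that by (intro zero) (force simp: image_iff)
  qed
  have q0: "(\<integral>x. q n x \<partial>lborel) = 0" for n
    using gint shift[of "s n *\<^sub>R v"]
    by (simp add: q_def integral_lborel_translate[OF gmeas])
  have bound: "norm (q n x) \<le> w x" for n x
  proof (cases "norm x \<le> r + norm v")
    case True
    obtain t where t: "0 < t" "t < s n"
      "g (x + s n *\<^sub>R v) - g (x + 0 *\<^sub>R v) = (s n - 0) * g' (x + t *\<^sub>R v) v"
      using MVT2[OF s(1)[of n], of "\<lambda>t. g (x + t *\<^sub>R v)" "\<lambda>t. g' (x + t *\<^sub>R v) v"]
        has_real_derivative_along_line[OF der] by blast
    have "norm (t *\<^sub>R v) \<le> 1 * norm v"
      unfolding norm_scaleR using t s(2)[of n] by (intro mult_right_mono) auto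
    then have "norm (x + t *\<^sub>R v) \<le> r + 2 * norm v"
      using True norm_triangle_ineq[of x "t *\<^sub>R v"] by linarith
    then show ?thesis
      using True t(3) s(1)[of n] M by (simp add: q_def w_def)
  next
    case False
    have "norm (s n *\<^sub>R v) \<le> 1 * norm v"
      unfolding norm_scaleR using s[of n] by (intro mult_right_mono) auto
    then have "norm (x + s n *\<^sub>R v) > r"
      using False norm_diff_ineq[of x "s n *\<^sub>R v"] by linarith
    moreover have "norm x > r"
      using False norm_ge_zero[of v] by linarith
    ultimately have "x \<notin> K" "x + s n *\<^sub>R v \<notin> K"
      using r by force+
    then show ?thesis
      using False by (simp add: q_def w_def zero)
  qed
  have "(\<lambda>n. q n x) \<longlonglongrightarrow> g' x v" for x
  proof -
    have "((\<lambda>t. g (x + t *\<^sub>R v)) has_real_derivative g' x v) (at 0)"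
      using has_real_derivative_along_line[of g "g' x" x 0 v] der by simp
    then have "(\<lambda>h. (g (x + h *\<^sub>R v) - g x) / h) \<midarrow>0\<rightarrow> g' x v"
      by (simp add: DERIV_def)
    moreover have "s n \<noteq> 0" for n
      using s(1)[of n] by simp
    ultimately show ?thesis
      using s0 unfolding q_def by (auto simp: LIMSEQ_SEQ_conv[symmetric])
  qed
  moreover have "integrable lborel w"
    unfolding w_def by (intro borel_integrable_compact) auto
  moreover have "q n \<in> borel_measurable lborel" for n
    using gmeas shift[THEN borel_measurable_integrable] by (simp add: q_def[abs_def])
  ultimately have "(\<lambda>n. \<integral>x. q n x \<partial>lborel) \<longlonglongrightarrow> (\<integral>x. g' x v \<partial>lborel)"
    using borel_measurable_continuous_onI[OF cont] bound
    by (intro integral_dominated_convergence[where w = w]) auto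
  then show ?thesis
    by (simp add: q0 LIMSEQ_const_iff)
qed

section \<open>Derivatives of test functions\<close>

text \<open>Two applications of the mean value theorem, first along \<open>a\<close>, then along
  \<open>b\<close>. The second difference is symmetric in \<open>a\<close> and \<open>b\<close>,
  which makes it a common value for the two mixed partials.\<close>

lemma second_difference_mean_value:
  fixes \<phi> :: "'a::euclidean_space \<Rightarrow> real"
  assumes "\<And>x. \<phi> differentiable (at x)" "\<And>x. partial a \<phi> differentiable (at x)" "0 < h"
  shows "\<exists>s t. 0 < s \<and> s < h \<and> 0 < t \<and> t < h \<and>
    \<phi> (p + h *\<^sub>R a + h *\<^sub>R b) - \<phi> (p + h *\<^sub>R a) - \<phi> (p + h *\<^sub>R b) + \<phi> p =
    h * h * partial b (partial a \<phi>) (p + s *\<^sub>R a + t *\<^sub>R b)"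
proof -
  have d1: "((\<lambda>s. \<phi> (x + s *\<^sub>R a)) has_real_derivative partial a \<phi> (x + s *\<^sub>R a)) (at s)" for x s
    using assms(1) unfolding partial_def
    by (intro has_real_derivative_along_line) (simp flip: frechet_derivative_works)
  have d2: "((\<lambda>t. partial a \<phi> (x + t *\<^sub>R b)) has_real_derivative
      partial b (partial a \<phi>) (x + t *\<^sub>R b)) (at t)" for x t
    using assms(2) unfolding partial_def[of b]
    by (intro has_real_derivative_along_line) (simp flip: frechet_derivative_works)
  \<comment> \<open>The function of \<open>s\<close> here is \<open>\<phi> (p + h *\<^sub>R b + s
    *\<^sub>R a) - \<phi> (p + s *\<^sub>R a)\<close>; the terms with \<open>0 *\<^sub>R a\<close>
    are its value at the left endpoint.\<close>
  have "\<exists>s>0. s < h \<and>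
      (\<phi> (p + h *\<^sub>R b + h *\<^sub>R a) - \<phi> (p + h *\<^sub>R a)) - (\<phi> (p + h *\<^sub>R b + 0 *\<^sub>R a) - \<phi> (p + 0 *\<^sub>R a)) =
      (h - 0) * (partial a \<phi> (p + h *\<^sub>R b + s *\<^sub>R a) - partial a \<phi> (p + s *\<^sub>R a))"
    using \<open>0 < h\<close> by (intro MVT2 DERIV_diff d1) auto
  then obtain s where s: "0 < s" "s < h"
    "\<phi> (p + h *\<^sub>R b + h *\<^sub>R a) - \<phi> (p + h *\<^sub>R a) - (\<phi> (p + h *\<^sub>R b) - \<phi> p) =
      h * (partial a \<phi> (p + h *\<^sub>R b + s *\<^sub>R a) - partial a \<phi> (p + s *\<^sub>R a))"
    by auto
  have "\<exists>t>0. t < h \<and>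
      partial a \<phi> (p + s *\<^sub>R a + h *\<^sub>R b) - partial a \<phi> (p + s *\<^sub>R a + 0 *\<^sub>R b) =
      (h - 0) * partial b (partial a \<phi>) (p + s *\<^sub>R a + t *\<^sub>R b)"
    using \<open>0 < h\<close> by (intro MVT2 d2) auto
  then obtain t where t: "0 < t" "t < h"
    "partial a \<phi> (p + s *\<^sub>R a + h *\<^sub>R b) - partial a \<phi> (p + s *\<^sub>R a) =
      h * partial b (partial a \<phi>) (p + s *\<^sub>R a + t *\<^sub>R b)"
    by auto
  show ?thesis
    using s t by (intro exI[of _ s] exI[of _ t]) (simp add: algebra_simps)
qed

text \<open>Schwarz's theorem. At points shrinking to \<open>p\<close> both mixed partials equal the
  same second difference divided by \<open>s n * s n\<close>, so continuity at \<open>p\<close>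
  forces equal limits.\<close>

lemma partial_commute:
  fixes \<phi> :: "'a::euclidean_space \<Rightarrow> real"
  assumes "\<And>x. \<phi> differentiable (at x)"
    and "\<And>x. partial a \<phi> differentiable (at x)" "\<And>x. partial b \<phi> differentiable (at x)"
    and "isCont (partial b (partial a \<phi>)) p" "isCont (partial a (partial b \<phi>)) p"
  shows "partial a (partial b \<phi>) p = partial b (partial a \<phi>) p"
proof -
  define s where "s n = inverse (real (Suc n))" for n
  have s: "0 < s n" for n
    by (auto simp: s_def)
  have s0: "s \<longlonglongrightarrow> 0"
    unfolding s_def by (rule LIMSEQ_inverse_real_of_nat)
  have squeeze: "u \<longlonglongrightarrow> 0" if "\<And>n. 0 < u n \<and> u n < s n" for u
    using that by (intro real_tendsto_sandwich[OF _ _ tendsto_const s0] always_eventually) (auto intro: less_imp_le)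
  have "\<exists>u v u' v'. 0 < u \<and> u < s n \<and> 0 < v \<and> v < s n \<and> 0 < u' \<and> u' < s n \<and> 0 < v' \<and> v' < s n \<and>
    partial b (partial a \<phi>) (p + u *\<^sub>R a + v *\<^sub>R b) = partial a (partial b \<phi>) (p + u' *\<^sub>R b + v' *\<^sub>R a)" for n
  proof -
    obtain u v where uv: "0 < u" "u < s n" "0 < v" "v < s n"
      "\<phi> (p + s n *\<^sub>R a + s n *\<^sub>R b) - \<phi> (p + s n *\<^sub>R a) - \<phi> (p + s n *\<^sub>R b) + \<phi> p =
        s n * s n * partial b (partial a \<phi>) (p + u *\<^sub>R a + v *\<^sub>R b)"
      using second_difference_mean_value[of \<phi> a "s n" p b] assms s by blast
    obtain u' v' where uv': "0 < u'" "u' < s n" "0 < v'" "v' < s n"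
      "\<phi> (p + s n *\<^sub>R b + s n *\<^sub>R a) - \<phi> (p + s n *\<^sub>R b) - \<phi> (p + s n *\<^sub>R a) + \<phi> p =
        s n * s n * partial a (partial b \<phi>) (p + u' *\<^sub>R b + v' *\<^sub>R a)"
      using second_difference_mean_value[of \<phi> b "s n" p a] assms s by blast
    have "s n * s n * partial b (partial a \<phi>) (p + u *\<^sub>R a + v *\<^sub>R b) =
        s n * s n * partial a (partial b \<phi>) (p + u' *\<^sub>R b + v' *\<^sub>R a)"
      unfolding uv(5)[symmetric] uv'(5)[symmetric] by (simp add: algebra_simps)
    then show ?thesis
      using s[of n] uv uv' by (metis less_irrefl mult_left_cancel mult_pos_pos)
  qed
  then obtain u v u' v' where uv:
    "\<And>n. 0 < u n \<and> u n < s n" "\<And>n. 0 < v n \<and> v n < s n"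
    "\<And>n. 0 < u' n \<and> u' n < s n" "\<And>n. 0 < v' n \<and> v' n < s n"
    and eq: "\<And>n. partial b (partial a \<phi>) (p + u n *\<^sub>R a + v n *\<^sub>R b) =
      partial a (partial b \<phi>) (p + u' n *\<^sub>R b + v' n *\<^sub>R a)"
    by metis
  note lims = uv[THEN squeeze]
  have "(\<lambda>n. p + u n *\<^sub>R a + v n *\<^sub>R b) \<longlonglongrightarrow> p + 0 *\<^sub>R a + 0 *\<^sub>R b"
    by (intro tendsto_intros lims)
  then have 1: "(\<lambda>n. partial b (partial a \<phi>) (p + u n *\<^sub>R a + v n *\<^sub>R b)) \<longlonglongrightarrow> partial b (partial a \<phi>) p"
    by (intro isCont_tendsto_compose[OF assms(4)]) simp
  have "(\<lambda>n. p + u' n *\<^sub>R b + v' n *\<^sub>R a) \<longlonglongrightarrow> p + 0 *\<^sub>R b + 0 *\<^sub>R a"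
    by (intro tendsto_intros lims)
  then have "(\<lambda>n. partial a (partial b \<phi>) (p + u' n *\<^sub>R b + v' n *\<^sub>R a)) \<longlonglongrightarrow> partial a (partial b \<phi>) p"
    by (intro isCont_tendsto_compose[OF assms(5)]) simp
  with 1 show ?thesis
    unfolding eq by (rule LIMSEQ_unique[rotated])
qed

section \<open>Calculus of \<open>partial\<close> and stability of test functions under it\<close>

lemma partial_linear:
  assumes "f differentiable (at p)"
  shows "linear (\<lambda>v. partial v f p)"
  using has_derivative_linear assms unfolding partial_def frechet_derivative_works by blast

lemma has_derivative_partial:
  assumes "f differentiable (at p)"
  shows "(f has_derivative (\<lambda>v. partial v f p)) (at p)"
  using assms unfolding partial_def frechet_derivative_works .

lemma partial_eq:
  assumes "(f has_derivative f') (at p)"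
  shows "partial v f p = f' v"
  using frechet_derivative_at[OF assms] by (simp add: partial_def)

lemma test_function_differentiable:
  assumes "\<phi> \<in> test_functions \<Omega>"
  shows "\<phi> differentiable (at p)"
proof -
  have "smooth \<phi>"
    using assms by (simp add: test_functions_def)
  then have "foldr partial [] \<phi> differentiable (at p)"
    unfolding smooth_def by (metis empty_set empty_subsetI)
  then show ?thesis by simp
qed

lemma test_function_eq_0:
  assumes "\<phi> \<in> test_functions \<Omega>" "p \<notin> \<Omega>"
  shows "\<phi> p = 0"
  using assms closure_subset[of "{p. \<phi> p \<noteq> 0}"] unfolding test_functions_def by blast

lemma partial_eq_0_outside_support:
  assumes "p \<notin> closure {x. \<phi> x \<noteq> 0}"
  shows "partial v \<phi> p = 0"
proof -
  have "((\<lambda>_. 0) has_derivative (\<lambda>_. 0)) (at p)"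
    by simp
  then have "(\<phi> has_derivative (\<lambda>_. 0)) (at p)"
  proof (rule has_derivative_transform_within_open)
    show "open (- closure {x. \<phi> x \<noteq> 0})"
      by auto
    show "p \<in> - closure {x. \<phi> x \<noteq> 0}"
      using assms by simp
    show "0 = \<phi> x" if "x \<in> - closure {x. \<phi> x \<noteq> 0}" for x
      using that closure_subset[of "{x. \<phi> x \<noteq> 0}"] by auto
  qed
  then show ?thesis by (rule partial_eq)
qed

lemma partial_test_function:
  assumes "\<phi> \<in> test_functions \<Omega>" "b \<in> Basis"
  shows "partial b \<phi> \<in> test_functions \<Omega>"
proof -
  have "foldr partial bs (partial b \<phi>) differentiable (at x)" if "set bs \<subseteq> Basis" for bs x
  proof -
    \<comment> \<open>\<open>foldr\<close> applies the last list entry first, so appending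
      \<open>b\<close> differentiates by \<open>b\<close> before all of \<open>bs\<close>.\<close>
    have "set (bs @ [b]) \<subseteq> Basis" "smooth \<phi>"
      using assms that by (simp_all add: test_functions_def)
    then have "foldr partial (bs @ [b]) \<phi> differentiable (at x)"
      unfolding smooth_def by blast
    then show ?thesis by simp
  qed
  then have "smooth (partial b \<phi>)"
    by (simp add: smooth_def)
  moreover have sub: "closure {x. partial b \<phi> x \<noteq> 0} \<subseteq> closure {x. \<phi> x \<noteq> 0}"
    using partial_eq_0_outside_support by (intro closure_minimal) auto
  moreover have "compact (closure {x. partial b \<phi> x \<noteq> 0})"
    using compact_Int_closed[of "closure {x. \<phi> x \<noteq> 0}" "closure {x. partial b \<phi> x \<noteq> 0}"] assms(1) sub
    by (simp add: test_functions_def inf.absorb2)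
  ultimately show ?thesis
    using assms unfolding test_functions_def by blast
qed

lemma differentiable_imp_continuous_on_UNIV:
  "(\<And>x. f differentiable (at x)) \<Longrightarrow> continuous_on UNIV f"
  by (simp add: differentiable_at_imp_differentiable_on differentiable_imp_continuous_on)

lemma axis_1_in_Basis: "axis i 1 \<in> (Basis :: (real^'n) set)"
  by (simp add: axis_in_Basis_iff)

text \<open>Smoothness speaks of basis directions only. Linearity of the derivative extends
  continuity to every direction, including the null direction \<open>axis 0 1 + axis 3 1\<close>
  needed on the wavefront.\<close>

lemma continuous_on_partial_test_function:
  fixes \<phi> :: "real^'n \<Rightarrow> real"
  assumes "\<phi> \<in> test_functions \<Omega>"
  shows "continuous_on UNIV (partial v \<phi>)"
proof -
  have lin: "linear (\<lambda>v. partial v \<phi> p)" for p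
    by (intro partial_linear test_function_differentiable[OF assms])
  have "partial v \<phi> p = (\<Sum>i\<in>UNIV. v $ i * partial (axis i 1) \<phi> p)" for p
  proof -
    have "partial v \<phi> p = partial (\<Sum>i\<in>UNIV. v $ i *\<^sub>R axis i 1) \<phi> p"
      using basis_expansion[of v] by (simp add: scalar_mult_eq_scaleR)
    then show ?thesis
      by (simp add: linear_sum[OF lin] linear_scale[OF lin])
  qed
  then have "partial v \<phi> = (\<lambda>p. \<Sum>i\<in>UNIV. v $ i * partial (axis i 1) \<phi> p)"
    by auto
  moreover have "continuous_on UNIV (partial (axis i 1) \<phi>)" for i
    using assms axis_1_in_Basis
    by (intro differentiable_imp_continuous_on_UNIV test_function_differentiable partial_test_function)
  ultimately show ?thesis
    by (auto intro!: continuous_intros)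
qed

lemma partial_commute_test_function:
  fixes \<phi> :: "real^'n \<Rightarrow> real"
  assumes "\<phi> \<in> test_functions \<Omega>"
  shows "partial (axis i 1) (partial (axis j 1) \<phi>) = partial (axis j 1) (partial (axis i 1) \<phi>)"
proof
  fix p
  have T: "partial (axis k 1) \<phi> \<in> test_functions \<Omega>" for k
    using assms axis_1_in_Basis by (rule partial_test_function)
  have "isCont (partial v (partial (axis k 1) \<phi>)) p" for v k
    using continuous_on_partial_test_function[OF T] by (simp add: continuous_on_eq_continuous_at)
  then show "partial (axis i 1) (partial (axis j 1) \<phi>) p = partial (axis j 1) (partial (axis i 1) \<phi>) p"
    by (intro partial_commute test_function_differentiable[OF T] test_function_differentiable[OF assms])
qed

section \<open>The alternating symbol and the metric\<close>

lemma index_cases: "i = 0 \<or> i = 1 \<or> i = 2 \<or> i = 3" for i :: 4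
  using exhaust_4[of i] by auto

text \<open>Exchanging neighbouring arguments precomposes the map from positions to indices with a
  transposition, which preserves bijectivity and flips the sign. These three swaps generate all
  permutations.\<close>

lemma levi_civita_swap:
  "levi_civita \<beta> \<alpha> \<gamma> \<delta> = - levi_civita \<alpha> \<beta> \<gamma> \<delta>"
  "levi_civita \<alpha> \<gamma> \<beta> \<delta> = - levi_civita \<alpha> \<beta> \<gamma> \<delta>"
  "levi_civita \<alpha> \<beta> \<delta> \<gamma> = - levi_civita \<alpha> \<beta> \<gamma> \<delta>"
proof -
  define P where "P = (\<lambda>\<alpha> \<beta> \<gamma> \<delta> i::4. if i = 0 then \<alpha> else if i = 1 then \<beta> else if i = 2 then \<gamma> else \<delta>::4)"
  have lc: "levi_civita \<alpha> \<beta> \<gamma> \<delta> = (if bij (P \<alpha> \<beta> \<gamma> \<delta>) then of_int (sign (P \<alpha> \<beta> \<gamma> \<delta>)) else 0)"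
    for \<alpha> \<beta> \<gamma> \<delta>
    by (simp add: levi_civita_def P_def Let_def)
  have swap: "(if bij (p \<circ> Transposition.transpose i j) then real_of_int (sign (p \<circ> Transposition.transpose i j)) else 0) =
      - (if bij p then of_int (sign p) else 0)" if "i \<noteq> j" for p :: "4 \<Rightarrow> 4" and i j
  proof -
    have "bij (p \<circ> Transposition.transpose i j) \<longleftrightarrow> bij p"
      by (metis bij_comp bij_swap_iff bij_transpose comp_assoc comp_id transpose_comp_involutory)
    moreover have "sign (p \<circ> Transposition.transpose i j) = - sign p" if "bij p"
      using that \<open>i \<noteq> j\<close> by (simp add: sign_compose permutation permutation_swap_id sign_swap_id)
    ultimately show ?thesis by simp
  qed
  have "P \<beta> \<alpha> \<gamma> \<delta> = P \<alpha> \<beta> \<gamma> \<delta> \<circ> Transposition.transpose 0 1"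
    by (auto simp: P_def fun_eq_iff Transposition.transpose_def)
  then show "levi_civita \<beta> \<alpha> \<gamma> \<delta> = - levi_civita \<alpha> \<beta> \<gamma> \<delta>"
    by (simp only: lc) (intro swap, simp)
  have "P \<alpha> \<gamma> \<beta> \<delta> = P \<alpha> \<beta> \<gamma> \<delta> \<circ> Transposition.transpose 1 2"
    by (auto simp: P_def fun_eq_iff Transposition.transpose_def)
  then show "levi_civita \<alpha> \<gamma> \<beta> \<delta> = - levi_civita \<alpha> \<beta> \<gamma> \<delta>"
    by (simp only: lc) (intro swap, simp)
  have "P \<alpha> \<beta> \<delta> \<gamma> = P \<alpha> \<beta> \<gamma> \<delta> \<circ> Transposition.transpose 2 3"
    using index_cases by (auto simp: P_def fun_eq_iff Transposition.transpose_def)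
  then show "levi_civita \<alpha> \<beta> \<delta> \<gamma> = - levi_civita \<alpha> \<beta> \<gamma> \<delta>"
    by (simp only: lc) (intro swap, simp)
qed

lemma levi_civita_0123: "levi_civita 0 1 2 3 = 1"
proof -
  have "(\<lambda>i::4. if i = 0 then 0 else if i = 1 then 1 else if i = 2 then 2 else 3) = id"
    using index_cases by (auto simp: fun_eq_iff)
  then show ?thesis
    by (simp only: levi_civita_def Let_def) simp
qed

text \<open>A swap of equal neighbours makes the value its own negative; equal indices further apart
  are first moved together by swaps.\<close>

lemma levi_civita_eq_0 [simp]:
  "levi_civita \<alpha> \<alpha> \<gamma> \<delta> = 0" "levi_civita \<alpha> \<beta> \<alpha> \<delta> = 0" "levi_civita \<alpha> \<beta> \<gamma> \<alpha> = 0"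
  "levi_civita \<alpha> \<beta> \<beta> \<delta> = 0" "levi_civita \<alpha> \<beta> \<gamma> \<beta> = 0" "levi_civita \<alpha> \<beta> \<gamma> \<gamma> = 0"
  using levi_civita_swap[of \<alpha> \<alpha> \<gamma> \<delta>] levi_civita_swap[of \<alpha> \<alpha> \<beta> \<delta>] levi_civita_swap[of \<alpha> \<alpha> \<gamma> \<beta>]
    levi_civita_swap[of \<alpha> \<beta> \<alpha> \<delta>] levi_civita_swap[of \<alpha> \<beta> \<gamma> \<alpha>] levi_civita_swap[of \<alpha> \<gamma> \<beta> \<alpha>]
    levi_civita_swap[of \<alpha> \<beta> \<beta> \<delta>] levi_civita_swap[of \<alpha> \<beta> \<gamma> \<beta>] levi_civita_swap[of \<alpha> \<beta> \<gamma> \<gamma>]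
    levi_civita_swap[of \<alpha> \<gamma> \<beta> \<beta>]
  by linarith+

section \<open>Raising indices and the dual of an antisymmetric tensor\<close>

lemma eta_mult_eta: "eta ** eta = mat 1"
  by (auto simp: eta_def matrix_matrix_mult_def mat_def vec_eq_iff if_distrib[of "\<lambda>x. x * _"] cong: if_cong)

lemma matrix_inv_eta: "matrix_inv eta = eta"
proof -
  \<comment> \<open>\<open>matrix_inv\<close> is a choice, and \<open>eta\<close> as a witness shows
    that the chosen matrix is a two-sided inverse; uniqueness of inverses then identifies it with
    \<open>eta\<close>.\<close>
  have "eta ** matrix_inv eta = mat 1 \<and> matrix_inv eta ** eta = mat 1"
    unfolding matrix_inv_def using eta_mult_eta by (rule_tac someI[of _ eta]) auto
  then show ?thesis
    by (metis eta_mult_eta matrix_mul_assoc matrix_mul_lid matrix_mul_rid)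
qed

lemma sum_index: "sum f UNIV = f 0 + f 1 + f 2 + f (3::4)" for f :: "4 \<Rightarrow> real"
proof -
  have UNIV_eq: "UNIV = {0, 1, 2, 3::4}"
    using index_cases by blast
  show ?thesis
    unfolding UNIV_eq by (simp add: add.assoc)
qed

lemma raise_first_two_eq:
  "raise_first_two T \<gamma> \<delta> \<kappa> \<mu> \<phi> =
     (if \<gamma> = 0 then -1 else 1) * (if \<delta> = 0 then -1 else 1) * T \<gamma> \<delta> \<kappa> \<mu> \<phi>"
  unfolding raise_first_two_def matrix_inv_eta sum_index
  using index_cases[of \<gamma>] index_cases[of \<delta>]
  by (auto simp: eta_def)

text \<open>For fixed \<open>\<alpha> \<noteq> \<beta>\<close> only the complementary index pair
  survives, in its two orders; by antisymmetry of \<open>X\<close> these contribute equally and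
  cancel the factor 1/2. Six components suffice because \<open>Y\<close> is antisymmetric as
  well.\<close>

lemma levi_civita_dual:
  fixes X :: "4 \<Rightarrow> 4 \<Rightarrow> real"
  assumes "\<And>\<gamma> \<delta>. X \<delta> \<gamma> = - X \<gamma> \<delta>"
  defines "Y \<alpha> \<beta> \<equiv> 1/2 * (\<Sum>\<gamma>\<in>UNIV. \<Sum>\<delta>\<in>UNIV. levi_civita \<alpha> \<beta> \<gamma> \<delta> * X \<gamma> \<delta>)"
  shows "Y \<beta> \<alpha> = - Y \<alpha> \<beta>"
    and "Y 0 1 = X 2 3" "Y 0 2 = X 3 1" "Y 0 3 = X 1 2"
    and "Y 1 2 = X 0 3" "Y 1 3 = X 2 0" "Y 2 3 = X 0 1"
proof -
  show "Y \<beta> \<alpha> = - Y \<alpha> \<beta>"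
    unfolding Y_def by (subst levi_civita_swap(1)) (simp add: sum_negf)
  \<comment> \<open>All needed values are reached from \<open>levi_civita 0 1 2 3 = 1\<close> by
    adjacent swaps; some entries serve only as intermediate links.\<close>
  have "levi_civita 0 1 3 2 = -1" "levi_civita 0 2 1 3 = -1"
    using levi_civita_swap[of 0 1 2 3] levi_civita_0123 by auto
  moreover have "levi_civita 0 2 3 1 = 1" "levi_civita 2 0 1 3 = 1"
    using levi_civita_swap[of 0 2 1 3] calculation by auto
  moreover have "levi_civita 0 3 1 2 = 1"
    using levi_civita_swap[of 0 1 3 2] calculation by auto
  moreover have "levi_civita 0 3 2 1 = -1"
    using levi_civita_swap[of 0 2 3 1] calculation by auto
  moreover have "levi_civita 1 0 2 3 = -1" "levi_civita 1 0 3 2 = 1"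
    using levi_civita_swap(1)[of 0 1] levi_civita_0123 calculation by auto
  moreover have "levi_civita 1 2 0 3 = 1" "levi_civita 1 3 0 2 = -1"
    using levi_civita_swap(2)[of 1 2 0 3] levi_civita_swap(2)[of 1 3 0 2] calculation by auto
  moreover have "levi_civita 1 2 3 0 = -1" "levi_civita 1 3 2 0 = 1"
    using levi_civita_swap(3)[of 1 2 3 0] levi_civita_swap(3)[of 1 3 2 0] calculation by auto
  moreover have "levi_civita 2 0 3 1 = -1"
    using levi_civita_swap(3)[of 2 0 1 3] calculation by auto
  moreover have "levi_civita 2 3 0 1 = 1"
    using levi_civita_swap(2)[of 2 0 3 1] calculation by auto
  moreover have "levi_civita 2 3 1 0 = -1"
    using levi_civita_swap(3)[of 2 3 0 1] calculation by auto
  ultimately show "Y 0 1 = X 2 3" "Y 0 2 = X 3 1" "Y 0 3 = X 1 2"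
    "Y 1 2 = X 0 3" "Y 1 3 = X 2 0" "Y 2 3 = X 0 1"
    unfolding Y_def sum_index using levi_civita_0123
      assms(1)[of 0 1] assms(1)[of 0 2] assms(1)[of 0 3] assms(1)[of 1 2] assms(1)[of 1 3] assms(1)[of 2 3]
    by simp_all
qed

section \<open>Integration by parts on the null hyperplane\<close>

text \<open>Parametrizes the null hyperplane t = z by (x, y, z), the variables left in
  \<open>dirac_t_minus_z\<close> after evaluation at s = 0.\<close>

definition wavefront :: "real \<times> real \<times> real \<Rightarrow> real^4" where
  "wavefront q = event (snd (snd q)) (fst q) (fst (snd q)) (snd (snd q))"

lemma wavefront_nth [simp]:
  "wavefront q $ 0 = snd (snd q)" "wavefront q $ 1 = fst q"
  "wavefront q $ 2 = fst (snd q)" "wavefront q $ 3 = snd (snd q)"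
  by (simp_all add: wavefront_def event_def)

lemma vec4_eqI: "(u::real^4) $ 0 = v $ 0 \<Longrightarrow> u $ 1 = v $ 1 \<Longrightarrow> u $ 2 = v $ 2 \<Longrightarrow> u $ 3 = v $ 3 \<Longrightarrow> u = v"
  unfolding vec_eq_iff using index_cases by metis

lemma bounded_linear_wavefront: "bounded_linear wavefront"
  unfolding linear_conv_bounded_linear[symmetric]
  by (intro linearI vec4_eqI) simp_all

lemmas continuous_on_wavefront = linear_continuous_on[OF bounded_linear_wavefront]

text \<open>Forgetting t is a left inverse of \<open>wavefront\<close>, so the preimage is a closed
  subset of the compact projection of \<open>K\<close>.\<close>

lemma compact_wavefront_vimage:
  assumes "compact K"
  shows "compact (wavefront -` K)"
proof -
  let ?P = "\<lambda>p :: real^4. (p $ 1, p $ 2, p $ 3)"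
  have "q \<in> ?P ` K" if "wavefront q \<in> K" for q
    using imageI[OF that, of ?P] by simp
  then have "?P ` K \<inter> wavefront -` K = wavefront -` K"
    by auto
  moreover have "compact (?P ` K)"
    using assms by (intro compact_continuous_image continuous_intros)
  moreover have "closed (wavefront -` K)"
    using compact_imp_closed[OF assms] continuous_on_wavefront by (rule closed_vimage)
  ultimately show ?thesis
    using compact_Int_closed by fastforce
qed

text \<open>Moving in z along the hyperplane drags t along: the third direction becomes the null
  generator, not the z-axis.\<close>

lemma wavefront_basis:
  "wavefront (1, 0, 0) = axis 1 1" "wavefront (0, 1, 0) = axis 2 1"
  "wavefront (0, 0, 1) = axis 0 1 + axis 3 1"
  by (intro vec4_eqI; simp add: axis_def)+

lemma shock_distribution_eq:
  "distr_mult (\<lambda>p. F (p $ 1, p $ 2)) dirac_t_minus_z \<psi> =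
     (\<integral>q. F (fst q, fst (snd q)) * \<psi> (wavefront q) \<partial>lborel)"
  by (simp add: distr_mult_def dirac_t_minus_z_def dirac_def wavefront_def case_prod_unfold) (simp add: event_def)

text \<open>Outside \<open>D\<close> the values of \<open>h\<close> are arbitrary. The product is
  continuous on two open sets, over \<open>D\<close> and off \<open>K\<close>, where it vanishes;
  since \<open>K\<close> lies over \<open>D\<close>, they cover everything.\<close>

lemma
  fixes D :: "(real \<times> real) set" and h :: "real \<times> real \<Rightarrow> real" and \<psi> :: "real^4 \<Rightarrow> real"
  assumes "open D" and h: "continuous_on D h" and \<psi>: "continuous_on UNIV \<psi>"
    and K: "compact K" "K \<subseteq> {p. (p $ 1, p $ 2) \<in> D}" "\<And>p. p \<notin> K \<Longrightarrow> \<psi> p = 0"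
  shows continuous_on_wavefront_product:
      "continuous_on UNIV (\<lambda>q. h (fst q, fst (snd q)) * \<psi> (wavefront q))" (is ?cont)
    and integrable_wavefront_product:
      "integrable lborel (\<lambda>q. h (fst q, fst (snd q)) * \<psi> (wavefront q))"
proof -
  let ?f = "\<lambda>q. h (fst q, fst (snd q)) * \<psi> (wavefront q)"
  let ?A = "{q :: real \<times> real \<times> real. (fst q, fst (snd q)) \<in> D}" and ?B = "{q. wavefront q \<in> - K}"
  have "open ?A"
    using open_vimage[OF \<open>open D\<close>, of "\<lambda>q :: real \<times> real \<times> real. (fst q, fst (snd q))"]
    by (simp add: vimage_def continuous_on_Pair continuous_on_fst continuous_on_snd)
  moreover have "open ?B"
    using open_vimage[OF open_Compl[OF compact_imp_closed[OF K(1)]] continuous_on_wavefront]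
    by (simp add: vimage_def)
  ultimately have opens: "open ?A" "open ?B" .
  have "continuous_on ?A (\<lambda>q. h (fst q, fst (snd q)))"
    by (rule continuous_on_compose2[OF h]) (auto intro!: continuous_intros)
  moreover have "continuous_on ?A (\<lambda>q. \<psi> (wavefront q))"
    by (rule continuous_on_compose2[OF \<psi> continuous_on_wavefront]) auto
  ultimately have "continuous_on ?A ?f"
    by (rule continuous_on_mult)
  moreover have "continuous_on ?B ?f"
    by (rule continuous_on_eq[OF continuous_on_const[of _ 0]]) (simp add: K(3))
  ultimately have "continuous_on (?A \<union> ?B) ?f"
    using opens by (intro continuous_on_open_Un)
  moreover have "?A \<union> ?B = UNIV"
    using K(2) by fastforce
  ultimately show ?cont
    by simp
  then show "integrable lborel ?f"
  proof (rule integrable_lborel_compact_support)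
    show "compact (wavefront -` K)"
      using K(1) by (rule compact_wavefront_vimage)
    show "?f q = 0" if "q \<notin> wavefront -` K" for q
      using that K(3) by simp
  qed
qed

text \<open>The derivative of the compactly supported product along \<open>(a, b, c)\<close> has
  integral 0, and the Leibniz rule splits it. The component \<open>c\<close> does not act on
  \<open>f\<close>, which is constant in z.\<close>

lemma wavefront_integration_by_parts:
  assumes "open D" and f: "\<And>p. p \<in> D \<Longrightarrow> f differentiable (at p)"
    and f': "continuous_on D (partial (a, b) f)"
    and \<psi>: "\<psi> \<in> test_functions {p. (p $ 1, p $ 2) \<in> D}"
  shows "(\<integral>q. f (fst q, fst (snd q)) * partial (wavefront (a, b, c)) \<psi> (wavefront q) \<partial>lborel) =
    - (\<integral>q. partial (a, b) f (fst q, fst (snd q)) * \<psi> (wavefront q) \<partial>lborel)"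
proof -
  define K where "K = closure {p. \<psi> p \<noteq> 0}"
  let ?\<pi> = "\<lambda>q :: real \<times> real \<times> real. (fst q, fst (snd q))"
  \<comment> \<open>The Leibniz formula is used at every \<open>q\<close>; off \<open>D\<close> the
    unspecified values of \<open>f\<close> and its partials are multiplied by 0.\<close>
  let ?g' = "\<lambda>q v. f (?\<pi> q) * partial (wavefront v) \<psi> (wavefront q) + partial (?\<pi> v) f (?\<pi> q) * \<psi> (wavefront q)"
  have K: "compact K" "K \<subseteq> {p. (p $ 1, p $ 2) \<in> D}" "\<And>p. p \<notin> K \<Longrightarrow> \<psi> p = 0"
    "\<And>p. p \<notin> K \<Longrightarrow> partial v \<psi> p = 0" for v
    using \<psi> closure_subset[of "{p. \<psi> p \<noteq> 0}"] partial_eq_0_outside_support[of _ \<psi>]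
    by (auto simp: test_functions_def K_def)
  have cont: "continuous_on D f" "continuous_on UNIV \<psi>"
    using f test_function_differentiable[OF \<psi>]
    by (auto intro!: differentiable_imp_continuous_on differentiable_at_imp_differentiable_on)
  have summand1:
    "continuous_on UNIV (\<lambda>q. f (?\<pi> q) * partial (wavefront (a, b, c)) \<psi> (wavefront q))"
    "integrable lborel (\<lambda>q. f (?\<pi> q) * partial (wavefront (a, b, c)) \<psi> (wavefront q))"
    by (rule continuous_on_wavefront_product integrable_wavefront_product, rule \<open>open D\<close>, rule cont(1),
        rule continuous_on_partial_test_function[OF \<psi>], rule K(1), rule K(2), erule K(4))+
  have summand2:
    "continuous_on UNIV (\<lambda>q. partial (a, b) f (?\<pi> q) * \<psi> (wavefront q))"
    "integrable lborel (\<lambda>q. partial (a, b) f (?\<pi> q) * \<psi> (wavefront q))"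
    by (rule continuous_on_wavefront_product integrable_wavefront_product, rule \<open>open D\<close>, rule f',
        rule cont(2), rule K(1), rule K(2), erule K(3))+
  have "(\<integral>q. ?g' q (a, b, c) \<partial>lborel) = 0"
  proof (rule integral_directional_derivative_eq_0)
    fix q
    show "((\<lambda>q. f (?\<pi> q) * \<psi> (wavefront q)) has_derivative ?g' q) (at q)"
    proof (cases "?\<pi> q \<in> D")
      case True
      have "bounded_linear ?\<pi>"
        by (intro bounded_linear_intros)
      from has_derivative_compose[OF bounded_linear_imp_has_derivative[OF this] has_derivative_partial[OF f[OF True]]]
      have "((\<lambda>q. f (?\<pi> q)) has_derivative (\<lambda>v. partial (?\<pi> v) f (?\<pi> q))) (at q)" .
      moreover have "((\<lambda>q. \<psi> (wavefront q)) has_derivative (\<lambda>v. partial (wavefront v) \<psi> (wavefront q))) (at q)"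
        using has_derivative_compose[OF bounded_linear_imp_has_derivative[OF bounded_linear_wavefront]
          has_derivative_partial[OF test_function_differentiable[OF \<psi>]]] .
      ultimately show ?thesis
        by (rule has_derivative_mult)
    next
      case False
      \<comment> \<open>Here \<open>f\<close> may fail to be differentiable, but
        \<open>wavefront q\<close> stays off the closed set \<open>K\<close> in a neighbourhood of
        \<open>q\<close>, so the product is locally 0.\<close>
      then have notin: "wavefront q \<notin> K"
        using K(2) by auto
      have "((\<lambda>_. 0) has_derivative (\<lambda>_. 0)) (at q)"
        by simp
      then have "((\<lambda>q. f (?\<pi> q) * \<psi> (wavefront q)) has_derivative (\<lambda>_. 0)) (at q)"
      proof (rule has_derivative_transform_within_open)
        show "open (wavefront -` (- K))"
          by (intro open_vimage continuous_on_wavefront) (simp add: K_def open_Compl)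
      qed (use notin K(3) in auto)
      then show ?thesis
        using notin K(3,4) by simp
    qed
  next
    show "continuous_on UNIV (\<lambda>q. ?g' q (a, b, c))"
      using summand1(1) summand2(1) by (simp add: continuous_on_add)
    show "compact (wavefront -` K)"
      using K(1) by (rule compact_wavefront_vimage)
    show "f (?\<pi> q) * \<psi> (wavefront q) = 0" if "q \<notin> wavefront -` K" for q
      using that K(3) by simp
  qed
  then show ?thesis
    using summand1(2) summand2(2) by simp
qed

text \<open>With \<zeta> = y + ix the real part is y, so (x, y) enters as
  \<open>L (x, y) = Complex y x\<close>. The unit x-step becomes i and the unit y-step 1; comparing
  the parts of \<open>d * \<i>\<close> and \<open>d\<close> gives the Cauchy-Riemann equations with
  x and y in exchanged roles.\<close>

lemma holomorphic_conjugate_derivatives: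
  assumes "open D"
    and hol: "(\<lambda>\<zeta>. Complex (F (Im \<zeta>, Re \<zeta>)) (F' (Im \<zeta>, Re \<zeta>))) holomorphic_on {\<zeta>. (Im \<zeta>, Re \<zeta>) \<in> D}"
    and "p \<in> D"
  shows "F' differentiable (at p)"
    and "partial (1, 0) F' p = partial (0, 1) F p" "partial (0, 1) F' p = - partial (1, 0) F p"
proof -
  define G where "G = (\<lambda>\<zeta>. Complex (F (Im \<zeta>, Re \<zeta>)) (F' (Im \<zeta>, Re \<zeta>)))"
  define L where "L = (\<lambda>v :: real \<times> real. Complex (snd v) (fst v))"
  have "linear L"
    by (intro linearI) (simp_all add: L_def complex_eq_iff)
  then have L: "(L has_derivative L) (at p)"
    by (intro bounded_linear_imp_has_derivative) (simp add: linear_conv_bounded_linear)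
  have "open {\<zeta>. (Im \<zeta>, Re \<zeta>) \<in> D}"
    using open_vimage[OF \<open>open D\<close>, of "\<lambda>\<zeta>. (Im \<zeta>, Re \<zeta>)"]
    by (simp add: vimage_def continuous_intros)
  moreover have "L p \<in> {\<zeta>. (Im \<zeta>, Re \<zeta>) \<in> D}"
    using \<open>p \<in> D\<close> by (simp add: L_def)
  ultimately obtain d where "(G has_field_derivative d) (at (L p))"
    using hol holomorphic_on_imp_differentiable_at unfolding G_def field_differentiable_def by blast
  then have "((\<lambda>v. G (L v)) has_derivative (\<lambda>v. d * L v)) (at p)"
    using has_derivative_compose[OF L] by (simp add: has_field_derivative_def)
  note has_derivative_Re[OF this] has_derivative_Im[OF this]
  then have F: "(F has_derivative (\<lambda>v. Re (d * L v))) (at p)"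
    and F': "(F' has_derivative (\<lambda>v. Im (d * L v))) (at p)"
    by (simp_all add: G_def L_def)
  show "F' differentiable (at p)"
    using F' by (rule differentiableI)
  show "partial (1, 0) F' p = partial (0, 1) F p" "partial (0, 1) F' p = - partial (1, 0) F p"
    by (simp_all add: partial_eq[OF F] partial_eq[OF F'] L_def)
qed

section \<open>Transport and Cauchy-Riemann identities for F \<delta>(t - z)\<close>

abbreviation shock :: "(real \<times> real \<Rightarrow> real) \<Rightarrow> distr" where
  "shock F \<equiv> distr_mult (\<lambda>p. F (p $ 1, p $ 2)) dirac_t_minus_z"

text \<open>Integration by parts along the null generator, with
  \<open>(a, b, c) = (0, 0, 1)\<close>, differentiates \<open>F\<close> in the zero
  direction.\<close>

lemma shock_transport:
  assumes "open D" and F: "\<And>p. p \<in> D \<Longrightarrow> F differentiable (at p)"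
    and \<psi>: "\<psi> \<in> test_functions {p. (p $ 1, p $ 2) \<in> D}"
  shows "shock F (partial (axis 0 1) \<psi>) + shock F (partial (axis 3 1) \<psi>) = 0"
proof -
  let ?K = "closure {p. \<psi> p \<noteq> 0}"
  have zero: "partial (0, 0) F p = 0" if "p \<in> D" for p
    using linear_0[OF partial_linear[OF F[OF that]]] by (simp add: zero_prod_def)
  have cont0: "continuous_on D (partial (0, 0) F)"
    by (rule continuous_on_eq[OF continuous_on_const[of _ 0]]) (simp add: zero)
  have cont: "continuous_on D F"
    using F by (auto intro!: differentiable_imp_continuous_on differentiable_at_imp_differentiable_on)
  \<comment> \<open>Facts about \<open>F\<close> hold over \<open>D\<close> only; elsewhere the test
    function kills the integrand.\<close>
  have dich: "(fst q, fst (snd q)) \<in> D \<or> \<psi> (wavefront q) = 0" for q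
    using test_function_eq_0[OF \<psi>, of "wavefront q"] by auto
  have K: "compact ?K" "?K \<subseteq> {p. (p $ 1, p $ 2) \<in> D}"
    using \<psi> by (auto simp: test_functions_def)
  have int: "integrable lborel (\<lambda>q. F (fst q, fst (snd q)) * partial v \<psi> (wavefront q))" for v
    using \<open>open D\<close> cont continuous_on_partial_test_function[OF \<psi>] K partial_eq_0_outside_support
    by (rule integrable_wavefront_product)
  have add: "partial (axis 0 1 + axis 3 1) \<psi> p = partial (axis 0 1) \<psi> p + partial (axis 3 1) \<psi> p" for p
    using linear_add[OF partial_linear[OF test_function_differentiable[OF \<psi>]]] .
  have "shock F (partial (axis 0 1) \<psi>) + shock F (partial (axis 3 1) \<psi>) =
      (\<integral>q. F (fst q, fst (snd q)) * partial (axis 0 1 + axis 3 1) \<psi> (wavefront q) \<partial>lborel)"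
    unfolding shock_distribution_eq add
    by (simp add: Bochner_Integration.integral_add[OF int int, symmetric] distrib_left)
  also have "\<dots> = - (\<integral>q. partial (0, 0) F (fst q, fst (snd q)) * \<psi> (wavefront q) \<partial>lborel)"
    using wavefront_integration_by_parts[OF \<open>open D\<close> F cont0 \<psi>, of 1]
    by (simp add: wavefront_basis)
  also have "(\<lambda>q. partial (0, 0) F (fst q, fst (snd q)) * \<psi> (wavefront q)) = (\<lambda>_. 0)"
  proof
    show "partial (0, 0) F (fst q, fst (snd q)) * \<psi> (wavefront q) = 0" for q
      using dich[of q] by (elim disjE) (simp_all add: zero)
  qed
  finally show ?thesis
    by simp
qed

text \<open>One integration by parts puts the derivative on \<open>F'\<close>, the pointwise
  equations exchange it for a derivative of \<open>F\<close>, and a second integration by parts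
  returns it to \<open>\<psi>\<close>.\<close>

lemma shock_cauchy_riemann:
  assumes "open D" and F: "\<And>p. p \<in> D \<Longrightarrow> F differentiable (at p)" "\<And>p. p \<in> D \<Longrightarrow> F' differentiable (at p)"
    and cont: "continuous_on D (partial (1, 0) F)" "continuous_on D (partial (0, 1) F)"
    and CR: "\<And>p. p \<in> D \<Longrightarrow> partial (1, 0) F' p = partial (0, 1) F p"
      "\<And>p. p \<in> D \<Longrightarrow> partial (0, 1) F' p = - partial (1, 0) F p"
    and \<psi>: "\<psi> \<in> test_functions {p. (p $ 1, p $ 2) \<in> D}"
  shows "shock F' (partial (axis 1 1) \<psi>) = shock F (partial (axis 2 1) \<psi>)"
    and "shock F' (partial (axis 2 1) \<psi>) = - shock F (partial (axis 1 1) \<psi>)"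
proof -
  have dich: "(fst q, fst (snd q)) \<in> D \<or> \<psi> (wavefront q) = 0" for q
    using test_function_eq_0[OF \<psi>, of "wavefront q"] by auto
  \<comment> \<open>Continuity of the partials is assumed for \<open>F\<close> alone; the
    Cauchy-Riemann equations carry it over to \<open>F'\<close>.\<close>
  have cont': "continuous_on D (partial (1, 0) F')" "continuous_on D (partial (0, 1) F')"
    using continuous_on_eq[OF cont(2)] continuous_on_eq[OF continuous_on_minus[OF cont(1)]] CR by auto
  have "shock F' (partial (axis 1 1) \<psi>) =
      - (\<integral>q. partial (1, 0) F' (fst q, fst (snd q)) * \<psi> (wavefront q) \<partial>lborel)"
    unfolding shock_distribution_eq
    using wavefront_integration_by_parts[OF \<open>open D\<close> F(2) cont'(1) \<psi>, of 0] by (simp add: wavefront_basis)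
  also have "(\<lambda>q. partial (1, 0) F' (fst q, fst (snd q)) * \<psi> (wavefront q)) =
      (\<lambda>q. partial (0, 1) F (fst q, fst (snd q)) * \<psi> (wavefront q))"
  proof
    show "partial (1, 0) F' (fst q, fst (snd q)) * \<psi> (wavefront q) =
        partial (0, 1) F (fst q, fst (snd q)) * \<psi> (wavefront q)" for q
      using dich[of q] by (elim disjE) (simp_all add: CR)
  qed
  also have "- (\<integral>q. partial (0, 1) F (fst q, fst (snd q)) * \<psi> (wavefront q) \<partial>lborel) = shock F (partial (axis 2 1) \<psi>)"
    unfolding shock_distribution_eq
    using wavefront_integration_by_parts[OF \<open>open D\<close> F(1) cont(2) \<psi>, of 0] by (simp add: wavefront_basis)
  finally show "shock F' (partial (axis 1 1) \<psi>) = shock F (partial (axis 2 1) \<psi>)" .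
  have "shock F' (partial (axis 2 1) \<psi>) =
      - (\<integral>q. partial (0, 1) F' (fst q, fst (snd q)) * \<psi> (wavefront q) \<partial>lborel)"
    unfolding shock_distribution_eq
    using wavefront_integration_by_parts[OF \<open>open D\<close> F(2) cont'(2) \<psi>, of 0] by (simp add: wavefront_basis)
  also have "(\<lambda>q. partial (0, 1) F' (fst q, fst (snd q)) * \<psi> (wavefront q)) =
      (\<lambda>q. - (partial (1, 0) F (fst q, fst (snd q)) * \<psi> (wavefront q)))"
  proof
    show "partial (0, 1) F' (fst q, fst (snd q)) * \<psi> (wavefront q) =
        - (partial (1, 0) F (fst q, fst (snd q)) * \<psi> (wavefront q))" for q
      using dich[of q] by (elim disjE) (simp_all add: CR)
  qed
  also have "- (\<integral>q. - (partial (1, 0) F (fst q, fst (snd q)) * \<psi> (wavefront q)) \<partial>lborel) =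
      - shock F (partial (axis 1 1) \<psi>)"
    unfolding shock_distribution_eq
    using wavefront_integration_by_parts[OF \<open>open D\<close> F(1) cont(1) \<psi>, of 0] by (simp add: wavefront_basis)
  finally show "shock F' (partial (axis 2 1) \<psi>) = - shock F (partial (axis 1 1) \<psi>)" .
qed

section \<open>Curvature of a shock wave\<close>

text \<open>The covector \<open>k\<close> that is bound locally inside
  \<open>shock_wave\<close>.\<close>

definition null_covector :: "4 \<Rightarrow> real" where
  "null_covector i = (if i = 0 then 1 else if i = 3 then -1 else 0)"

lemma null_covector_simps [simp]:
  "null_covector 0 = 1" "null_covector 1 = 0" "null_covector 2 = 0" "null_covector 3 = -1"
  by (simp_all add: null_covector_def)

text \<open>
  Since \<open>R\<^bsub>\<alpha>\<beta>\<kappa>\<mu>\<^esub> = k\<^sub>\<beta> V\<^sub>\<alpha> - k\<^sub>\<alpha> V\<^sub>\<beta>\<close>, where \<open>\<kappa>, \<mu>\<close> and the test function enter only through the covector \<open>V\<close>,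
  duality has to be checked for one pair of indices only.
\<close>

definition shock_curvature_form :: "(real \<times> real \<Rightarrow> real) \<Rightarrow> (real^4 \<Rightarrow> real) \<Rightarrow> 4 \<Rightarrow> 4 \<Rightarrow> 4 \<Rightarrow> real" where
  "shock_curvature_form F \<phi> \<kappa> \<mu> \<alpha> = 1/2 *
     (null_covector \<kappa> * shock F (partial (axis \<alpha> 1) (partial (axis \<mu> 1) \<phi>))
    - null_covector \<mu> * shock F (partial (axis \<alpha> 1) (partial (axis \<kappa> 1) \<phi>)))"

text \<open>The signs of two distributional derivatives cancel, but their order on
  \<open>\<phi>\<close> is reversed. Commuting the partials puts \<open>\<alpha>\<close> or
  \<open>\<beta>\<close> outermost, so that the shock identities apply with an inner derivative of
  \<open>\<phi>\<close> as test function.\<close>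

lemma lin_riemann_shock_wave:
  assumes "\<phi> \<in> test_functions \<Omega>"
  shows "lin_riemann (shock_wave F) \<alpha> \<beta> \<kappa> \<mu> \<phi> =
    null_covector \<beta> * shock_curvature_form F \<phi> \<kappa> \<mu> \<alpha> - null_covector \<alpha> * shock_curvature_form F \<phi> \<kappa> \<mu> \<beta>"
proof -
  have "shock_wave F i j = (\<lambda>\<psi>. null_covector i * null_covector j * shock F \<psi>)" for i j
    by (simp add: shock_wave_def null_covector_def Let_def)
  then have "lin_riemann (shock_wave F) \<alpha> \<beta> \<kappa> \<mu> \<phi> = 1/2 *
     (null_covector \<beta> * null_covector \<kappa> * shock F (partial (axis \<mu> 1) (partial (axis \<alpha> 1) \<phi>))
    - null_covector \<beta> * null_covector \<mu> * shock F (partial (axis \<kappa> 1) (partial (axis \<alpha> 1) \<phi>))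
    - null_covector \<alpha> * null_covector \<kappa> * shock F (partial (axis \<mu> 1) (partial (axis \<beta> 1) \<phi>))
    + null_covector \<alpha> * null_covector \<mu> * shock F (partial (axis \<kappa> 1) (partial (axis \<beta> 1) \<phi>)))"
    by (simp add: lin_riemann_def distr_deriv_def)
  then show ?thesis
    unfolding shock_curvature_form_def partial_commute_test_function[OF assms, of \<alpha>]
      partial_commute_test_function[OF assms, of \<beta>]
    by (simp add: algebra_simps)
qed

theorem mainTheorem6:
  fixes D :: "(real \<times> real) set" and F F' :: "real \<times> real \<Rightarrow> real"
  assumes "open D"
    and "harmonic_on D F"
    and "(\<lambda>\<zeta>. Complex (F (Im \<zeta>, Re \<zeta>)) (F' (Im \<zeta>, Re \<zeta>))) holomorphic_on {\<zeta>. (Im \<zeta>, Re \<zeta>) \<in> D}"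
  shows "\<forall>\<alpha> \<beta> \<kappa> \<mu>. \<forall>\<phi>\<in>test_functions {p. (p $ 1, p $ 2) \<in> D}.
           lin_riemann (shock_wave F') \<alpha> \<beta> \<kappa> \<mu> \<phi> =
           1/2 * (\<Sum>\<gamma>\<in>UNIV. \<Sum>\<delta>\<in>UNIV. levi_civita \<alpha> \<beta> \<gamma> \<delta> *
                    raise_first_two (lin_riemann (shock_wave F)) \<gamma> \<delta> \<kappa> \<mu> \<phi>)"
proof (intro allI ballI)
  fix \<alpha> \<beta> \<kappa> \<mu> :: 4 and \<phi> :: "real^4 \<Rightarrow> real"
  assume \<phi>: "\<phi> \<in> test_functions {p. (p $ 1, p $ 2) \<in> D}"
  have basis: "(1, 0) \<in> (Basis :: (real \<times> real) set)" "(0, 1) \<in> (Basis :: (real \<times> real) set)"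
    by (auto simp: Basis_prod_def)
  have F: "F differentiable (at p)" if "p \<in> D" for p
    using assms(2) that by (simp add: harmonic_on_def)
  have cont: "continuous_on D (partial (1, 0) F)" "continuous_on D (partial (0, 1) F)"
    using assms(2) basis unfolding harmonic_on_def
    by (auto intro!: differentiable_imp_continuous_on differentiable_at_imp_differentiable_on)
  note conj = holomorphic_conjugate_derivatives[OF assms(1,3)]
  have d\<phi>: "partial (axis i 1) \<phi> \<in> test_functions {p. (p $ 1, p $ 2) \<in> D}" for i
    using \<phi> axis_1_in_Basis by (rule partial_test_function)
  define V where "V = shock_curvature_form F \<phi> \<kappa> \<mu>"
  define V' where "V' = shock_curvature_form F' \<phi> \<kappa> \<mu>"
  \<comment> \<open>Used with the test functions \<open>partial (axis \<kappa> 1) \<phi>\<close> and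
    \<open>partial (axis \<mu> 1) \<phi>\<close>, the inner derivatives in \<open>V\<close> and
    \<open>V'\<close>.\<close>
  note shock_cauchy_riemann[OF \<open>open D\<close> F conj(1) cont conj(2,3) d\<phi>]
  then have transverse: "V' 1 = V 2" "V' 2 = - V 1"
    by (simp_all add: V_def V'_def shock_curvature_form_def algebra_simps)
  have "shock F (partial (axis 0 1) (partial (axis i 1) \<phi>)) = - shock F (partial (axis 3 1) (partial (axis i 1) \<phi>))"
    "shock F' (partial (axis 0 1) (partial (axis i 1) \<phi>)) = - shock F' (partial (axis 3 1) (partial (axis i 1) \<phi>))" for i
    using shock_transport[OF \<open>open D\<close> F d\<phi>] shock_transport[OF \<open>open D\<close> conj(1) d\<phi>]
    by (simp_all add: eq_neg_iff_add_eq_0)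
  then have longitudinal: "V 0 = - V 3" "V' 0 = - V' 3"
    by (simp_all add: V_def V'_def shock_curvature_form_def field_simps)
  define X where "X \<gamma> \<delta> = raise_first_two (lin_riemann (shock_wave F)) \<gamma> \<delta> \<kappa> \<mu> \<phi>" for \<gamma> \<delta>
  have X: "X \<gamma> \<delta> = (if \<gamma> = 0 then -1 else 1) * (if \<delta> = 0 then -1 else 1) *
      (null_covector \<delta> * V \<gamma> - null_covector \<gamma> * V \<delta>)" for \<gamma> \<delta>
    by (simp add: X_def raise_first_two_eq lin_riemann_shock_wave[OF \<phi>] V_def)
  define Y where "Y \<alpha> \<beta> = 1/2 * (\<Sum>\<gamma>\<in>UNIV. \<Sum>\<delta>\<in>UNIV. levi_civita \<alpha> \<beta> \<gamma> \<delta> * X \<gamma> \<delta>)" for \<alpha> \<beta>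
  have "X \<delta> \<gamma> = - X \<gamma> \<delta>" for \<gamma> \<delta>
    by (simp add: X)
  note dual = levi_civita_dual[of X, OF this, folded Y_def]
  have "Y \<alpha> \<alpha> = 0" for \<alpha>
    by (simp add: Y_def)
  \<comment> \<open>The pairs (0,3) and (1,2) hold because both sides vanish, by
    \<open>longitudinal\<close> for \<open>V'\<close> and \<open>V\<close> respectively. The other
    four pairs mix one of 0, 3 with one of 1, 2 and reduce to \<open>transverse\<close>; reversed
    pairs follow by antisymmetry.\<close>
  then have "null_covector \<beta> * V' \<alpha> - null_covector \<alpha> * V' \<beta> = Y \<alpha> \<beta>"
    using index_cases[of \<alpha>] index_cases[of \<beta>]
      dual(1)[of 1 0] dual(1)[of 2 0] dual(1)[of 3 0] dual(1)[of 2 1] dual(1)[of 3 1] dual(1)[of 3 2]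
    by (elim disjE) (simp_all add: dual(2-) X transverse longitudinal)
  then show "lin_riemann (shock_wave F') \<alpha> \<beta> \<kappa> \<mu> \<phi> =
      1/2 * (\<Sum>\<gamma>\<in>UNIV. \<Sum>\<delta>\<in>UNIV. levi_civita \<alpha> \<beta> \<gamma> \<delta> *
        raise_first_two (lin_riemann (shock_wave F)) \<gamma> \<delta> \<kappa> \<mu> \<phi>)"
    by (simp add: lin_riemann_shock_wave[OF \<phi>] V'_def Y_def X_def)
qed

end
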